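(* Let $0\leq p\leq n$ and let $f_{n,p}$ be the number of maximal hypercubes of dimension $p$ in the Fibonacci cube $\Gamma_n$. Then \[f_{n,p}=\binom{p+1}{n-2p+1}.\]
   Context: $Q_n$ is the $n$-dimensional hypercube: vertices are binary strings of length $n$, adjacent iff they differ in exactly one coordinate. A Fibonacci string of length $n$ is a binary string $b_1\dots b_n$ with $b_ib_{i+1}=0$ for $1\le i<n$; the Fibonacci cube $\Gamma_n$ ($n\ge1$) is the subgraph of $Q_n$ induced by the Fibonacci strings of length $n$, and $\Gamma_0=K_1$. A hypercube of dimension $p$ in $\Gamma_n$ is an induced subgraph isomorphic to $Q_p$; it is maximal if it is not contained in any induced subgraph of $\Gamma_n$ isomorphic to $Q_{p+1}$. Binomial coefficients $\binom{a}{b}$ are $0$ when $b<0$ or $b>a$. *)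

theory Defs
  imports "Graph_Theory.Graph_Theory"
begin

text \<open>
  Simple undirected graphs are represented, as usual in this library, as symmetric loop-free
  digraphs: an undirected edge is a pair of opposite arcs (cf. the locale \<^locale>\<open>pair_graph\<close>).
  The bit \<open>1\<close> is \<^const>\<open>True\<close>, and \<open>xs ! i\<close> is the coordinate with index \<open>i + 1\<close>.
\<close>

definition hypercube :: "nat \<Rightarrow> bool list pair_pre_digraph" where
  "hypercube n = \<lparr> pverts = {xs. length xs = n},
     parcs = {(xs, ys). length xs = n \<and> length ys = n \<and> (\<exists>!i. i < n \<and> xs ! i \<noteq> ys ! i)} \<rparr>"

definition fib_string :: "bool list \<Rightarrow> bool" where
  "fib_string xs \<longleftrightarrow> (\<forall>i. Suc i < length xs \<longrightarrow> \<not> (xs ! i \<and> xs ! Suc i))"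

text \<open>
  For \<open>n = 0\<close> the only vertex is the empty string, so this is the one-vertex graph.
\<close>

definition fibonacci_cube :: "nat \<Rightarrow> (bool list, bool list \<times> bool list) pre_digraph" where
  "fibonacci_cube n = with_proj (hypercube n) \<restriction> {xs. length xs = n \<and> fib_string xs}"

definition hypercubes_in ::
  "nat \<Rightarrow> ('a, 'b) pre_digraph \<Rightarrow> ('a, 'b) pre_digraph set" where
  "hypercubes_in p G = {H. induced_subgraph H G \<and> digraph_iso H (with_proj (hypercube p))}"

definition maximal_hypercubes_in ::
  "nat \<Rightarrow> ('a, 'b) pre_digraph \<Rightarrow> ('a, 'b) pre_digraph set" where
  "maximal_hypercubes_in p G =
     {H \<in> hypercubes_in p G. \<not> (\<exists>K \<in> hypercubes_in (p + 1) G. subgraph H K)}"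

definition int_binomial :: "int \<Rightarrow> int \<Rightarrow> nat" where
  "int_binomial a b = (if b < 0 \<or> b > a then 0 else nat a choose nat b)"

text \<open>
  The notions of (induced) subgraph used above require well-formed digraphs, so they would be
  vacuous if the following failed.
\<close>

lemma pair_graph_hypercube: "pair_graph (hypercube n)"
proof unfold_locales
  have fin: "finite (pverts (hypercube n))"
    using finite_lists_length_eq[of "UNIV :: bool set" n] by (simp add: hypercube_def)
  then show "finite (pverts (hypercube n))" .
  have sub: "parcs (hypercube n) \<subseteq> pverts (hypercube n) \<times> pverts (hypercube n)"
    unfolding hypercube_def by clarsimp
  with fin show "finite (parcs (hypercube n))"
    by (meson finite_SigmaI finite_subset)
  have sym: "(ys, xs) \<in> parcs (hypercube n)" if "(xs, ys) \<in> parcs (hypercube n)" for xs ys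
  proof -
    have eq: "(\<lambda>i. i < n \<and> xs ! i \<noteq> ys ! i) = (\<lambda>i. i < n \<and> ys ! i \<noteq> xs ! i)"
      by (rule ext) blast
    from that have "length ys = n \<and> length xs = n \<and> (\<exists>!i. i < n \<and> xs ! i \<noteq> ys ! i)"
      by (simp add: hypercube_def)
    then show ?thesis
      unfolding eq by (simp add: hypercube_def)
  qed
  show "symmetric (with_proj (hypercube n))"
    unfolding symmetric_def with_proj_simps by (rule symI) (rule sym)
  fix e assume e: "e \<in> parcs (hypercube n)"
  with sub show "fst e \<in> pverts (hypercube n)" "snd e \<in> pverts (hypercube n)"
    by (metis mem_Times_iff subsetD)+
  show "fst e \<noteq> snd e"
  proof
    assume "fst e = snd e"
    with e show False
      by (cases e) (simp add: hypercube_def Ex1_def)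
  qed
qed

lemma wf_digraph_fibonacci_cube: "wf_digraph (fibonacci_cube n)"
proof -
  interpret pair_graph "hypercube n" by (rule pair_graph_hypercube)
  show ?thesis
    by unfold_locales (auto simp: fibonacci_cube_def)
qed

lemma induced_subgraph_fibonacci_cube:
  "induced_subgraph (fibonacci_cube n) (with_proj (hypercube n))"
proof -
  interpret pair_graph "hypercube n" by (rule pair_graph_hypercube)
  show ?thesis
    unfolding fibonacci_cube_def by (rule induced_induce) (auto simp: hypercube_def)
qed

end

(* A nonempty set of vertices of a hypercube in which every vertex has at least p neighbours
   has at least 2^p elements, and exactly 2^p only if it is a p-dimensional subcube; hence the
   hypercubes in the Fibonacci cube are exactly the subcubes [b, t] with t a Fibonacci string.
   Lowering b is always possible, so the maximal ones are the intervals [0, t] with t a Fibonacci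
   string in which no 0 can be changed to 1. Splitting off a leading 10 or 010 from such a t yields
   f(n+3, p+1) = f(n+1, p) + f(n, p), which is Pascal's rule. *)

theory Submission
  imports Defs
begin

section \<open>Strings differing in one position\<close>

text \<open>The relation is a parameter because three single-position changes share this recursion:
  flipping a bit, raising a 0 to a 1 (\<open><\<close>), and freeing a fixed coordinate of a pattern
  (\<open>frees\<close>).\<close>

fun one_step :: "('a \<Rightarrow> 'a \<Rightarrow> bool) \<Rightarrow> 'a list \<Rightarrow> 'a list \<Rightarrow> bool" where
  "one_step R (x # xs) (y # ys) \<longleftrightarrow> R x y \<and> xs = ys \<or> x = y \<and> one_step R xs ys"
| "one_step R _ _ \<longleftrightarrow> False"

lemma one_step_length: "one_step R xs ys \<Longrightarrow> length xs = length ys"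
  by (induction R xs ys rule: one_step.induct) auto

lemma one_step_Cons:
  "one_step R (x # xs) ys \<longleftrightarrow> (\<exists>y. R x y \<and> ys = y # xs) \<or> (\<exists>zs. ys = x # zs \<and> one_step R xs zs)"
  by (cases ys) auto

lemma ex_one_step_Cons:
  "(\<exists>ys. one_step R (x # xs) ys \<and> Q ys) \<longleftrightarrow>
    (\<exists>y. R x y \<and> Q (y # xs)) \<or> (\<exists>ys. one_step R xs ys \<and> Q (x # ys))"
  unfolding one_step_Cons by blast

definition adjacent :: "'a list \<Rightarrow> 'a list \<Rightarrow> bool" where
  "adjacent = one_step (\<noteq>)"

lemma adjacent_simps [simp]:
  "\<not> adjacent [] ys"
  "\<not> adjacent xs []"
  "adjacent (x # xs) (y # ys) \<longleftrightarrow> x \<noteq> y \<and> xs = ys \<or> x = y \<and> adjacent xs ys"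
  by (cases xs; simp add: adjacent_def)+

text \<open>Separates the index 0 from the successors, so that the unique differing position in
  \<open>hypercube\<close> can follow the list recursion of \<open>one_step\<close>.\<close>

lemma ex1_nat_iff:
  "(\<exists>!i. D i) \<longleftrightarrow> (if D 0 then \<forall>i. \<not> D (Suc i) else \<exists>!i. D (Suc i))"
proof (cases "D 0")
  case True
  have "(\<exists>!i. D i) \<longleftrightarrow> (\<forall>i. D i \<longrightarrow> i = 0)" using True by blast
  also have "\<dots> \<longleftrightarrow> (\<forall>i. \<not> D (Suc i))" using nat.exhaust by (metis nat.distinct(1))
  finally show ?thesis using True by simp
next
  case False
  have "\<exists>!i. D (Suc i)" if ex: "\<exists>!i. D i"
  proof -
    obtain i where i: "D i" and uniq: "\<And>k. D k \<Longrightarrow> k = i" using ex by (rule ex1E) blast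
    then obtain j where j: "i = Suc j" using False by (cases i) blast+
    have "k = j" if "D (Suc k)" for k using uniq[OF that] j by simp
    with i j show ?thesis by blast
  qed
  moreover have "\<exists>!i. D i" if ex: "\<exists>!i. D (Suc i)"
  proof -
    obtain j where j: "D (Suc j)" and uniq: "\<And>k. D (Suc k) \<Longrightarrow> k = j"
      using ex by (rule ex1E) blast
    have "k = Suc j" if "D k" for k
    proof (cases k)
      case (Suc l)
      then show ?thesis using uniq[of l] that by simp
    qed (use that False in simp)
    with j show ?thesis by blast
  qed
  ultimately have "(\<exists>!i. D i) \<longleftrightarrow> (\<exists>!i. D (Suc i))" by (rule iffI)
  then show ?thesis using False by (simp only: if_False)
qed

lemma adjacent_iff:
  "length xs = length ys \<Longrightarrow> adjacent xs ys \<longleftrightarrow> (\<exists>!i. i < length xs \<and> xs ! i \<noteq> ys ! i)"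
proof (induction xs ys rule: list_induct2)
  case Nil
  then show ?case by auto
next
  case (Cons x xs y ys)
  have "(\<forall>i. \<not> (i < length xs \<and> xs ! i \<noteq> ys ! i)) \<longleftrightarrow> xs = ys"
    using Cons.hyps by (auto simp: list_eq_iff_nth_eq)
  then show ?case
    unfolding ex1_nat_iff[of "\<lambda>i. i < length (x # xs) \<and> (x # xs) ! i \<noteq> (y # ys) ! i"]
    using Cons.IH by simp
qed

lemma parcs_hypercube:
  "parcs (hypercube n) = {(xs, ys). length xs = n \<and> length ys = n \<and> adjacent xs ys}"
proof -
  have "length xs = n \<and> length ys = n \<and> (\<exists>!i. i < n \<and> xs ! i \<noteq> ys ! i) \<longleftrightarrow>
      length xs = n \<and> length ys = n \<and> adjacent xs ys" for xs ys :: "bool list"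
    using adjacent_iff[of xs ys] by (intro conj_cong refl) simp
  then show ?thesis by (simp add: hypercube_def)
qed

section \<open>Subcubes\<close>

text \<open>A subcube is given by its pattern, in which \<^const>\<open>None\<close> marks a free coordinate.\<close>

fun subcube :: "bool option list \<Rightarrow> bool list set" where
  "subcube [] = {[]}"
| "subcube (Some b # P) = Cons b ` subcube P"
| "subcube (None # P) = Cons True ` subcube P \<union> Cons False ` subcube P"

fun free_dim :: "bool option list \<Rightarrow> nat" where
  "free_dim [] = 0"
| "free_dim (Some b # P) = free_dim P"
| "free_dim (None # P) = Suc (free_dim P)"

text \<open>This will be the vertex map of the isomorphism from a subcube onto a hypercube.\<close>

fun free_part :: "bool option list \<Rightarrow> bool list \<Rightarrow> bool list" where
  "free_part (Some b # P) (x # xs) = free_part P xs"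
| "free_part (None # P) (x # xs) = x # free_part P xs"
| "free_part _ _ = []"

lemma subcube_length: "xs \<in> subcube P \<Longrightarrow> length xs = length P"
  by (induction P arbitrary: xs rule: subcube.induct) auto

lemma finite_subcube: "finite (subcube P)"
  by (induction P rule: subcube.induct) auto

lemma subcube_nonempty: "subcube P \<noteq> {}"
  by (induction P rule: subcube.induct) auto

text \<open>Flipping a free coordinate stays in the subcube and flipping a fixed one leaves
  it.\<close>

lemma subcube_degree:
  "xs \<in> subcube P \<Longrightarrow> card {ys \<in> subcube P. adjacent xs ys} = free_dim P"
proof (induction P arbitrary: xs rule: subcube.induct)
  case 1
  then show ?case by simp
next
  case (2 b P)
  then obtain zs where zs: "xs = b # zs" "zs \<in> subcube P" by auto
  have "{ys \<in> subcube (Some b # P). adjacent xs ys} = Cons b ` {ys \<in> subcube P. adjacent zs ys}"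
    using zs by auto
  then show ?case using 2 zs by (simp add: card_image)
next
  case (3 P)
  then obtain b zs where zs: "xs = b # zs" "zs \<in> subcube P" by auto
  have "{ys \<in> subcube (None # P). adjacent xs ys} =
      insert ((\<not> b) # zs) (Cons b ` {ys \<in> subcube P. adjacent zs ys})"
    using zs by (cases b) auto
  then show ?case using 3 zs by (simp add: card_image finite_subcube image_iff)
qed

lemma free_part_inj:
  "xs \<in> subcube P \<Longrightarrow> ys \<in> subcube P \<Longrightarrow> free_part P xs = free_part P ys \<longleftrightarrow> xs = ys"
proof (induction P arbitrary: xs ys rule: subcube.induct)
  case (3 P)
  from "3.prems" obtain a b us vs
    where "xs = a # us" "ys = b # vs" "us \<in> subcube P" "vs \<in> subcube P" by auto
  with "3.IH"[of us vs] show ?case by simp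
qed auto

lemma free_part_image: "free_part P ` subcube P = {xs. length xs = free_dim P}"
proof (induction P rule: subcube.induct)
  case (3 P)
  have "free_part (None # P) ` subcube (None # P) =
      Cons True ` free_part P ` subcube P \<union> Cons False ` free_part P ` subcube P"
    by (simp add: image_Un image_image)
  also have "\<dots> = {xs. length xs = free_dim (None # P)}"
    unfolding "3.IH" by (auto simp: length_Suc_conv)
  finally show ?case .
qed (simp_all add: image_image)

text \<open>Strings of the subcube agree on all fixed coordinates, so every position where they
  differ survives in \<open>free_part\<close>.\<close>

lemma free_part_adjacent:
  "xs \<in> subcube P \<Longrightarrow> ys \<in> subcube P \<Longrightarrow>
    adjacent (free_part P xs) (free_part P ys) \<longleftrightarrow> adjacent xs ys"
proof (induction P arbitrary: xs ys rule: subcube.induct)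
  case (3 P)
  from "3.prems" obtain a b us vs
    where "xs = a # us" "ys = b # vs" "us \<in> subcube P" "vs \<in> subcube P" by auto
  with "3.IH"[of us vs] show ?case by (simp add: free_part_inj)
qed auto

text \<open>By splitting off the first coordinate; in the equality case with both halves nonempty, a vertex
  has only \<open>p - 1\<close> neighbours in its own half, so its mirror image lies in the other half.\<close>

lemma min_degree_card_subcube:
  assumes "\<And>xs. xs \<in> S \<Longrightarrow> length xs = n" and "S \<noteq> {}"
    and "\<And>xs. xs \<in> S \<Longrightarrow> p \<le> card {ys \<in> S. adjacent xs ys}"
  shows "2 ^ p \<le> card S \<and> (card S = 2 ^ p \<longrightarrow> (\<exists>P. length P = n \<and> free_dim P = p \<and> S = subcube P))"
  using assms
proof (induction n arbitrary: S p)
  case 0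
  then have S: "S = {[]}" by auto
  then have "p = 0" using "0.prems"(3)[of "[]"] by simp
  with S show ?case by (auto intro!: exI[of _ "[]"])
next
  case (Suc n)
  \<comment> \<open>\<open>T b\<close> is the half of \<open>S\<close> with first coordinate
    \<open>b\<close>, that coordinate being removed.\<close>
  define T where "T b = {xs. b # xs \<in> S}" for b
  have memT: "xs \<in> T b \<longleftrightarrow> b # xs \<in> S" for b xs by (simp add: T_def)
  have len: "length xs = n" if "xs \<in> T b" for b xs
    using Suc.prems(1) that by (force simp: memT)
  have fin: "finite (T b)" for b
    by (rule finite_subset[OF _ finite_lists_length_eq[of UNIV n]]) (use len in auto)
  have S: "S = Cons b ` T b \<union> Cons (\<not> b) ` T (\<not> b)" for b
  proof -
    have "xs \<in> S \<longleftrightarrow> xs \<in> Cons b ` T b \<union> Cons (\<not> b) ` T (\<not> b)" for xs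
    proof (cases xs)
      case Nil
      then show ?thesis using Suc.prems(1)[of xs] by auto
    next
      case (Cons a ys)
      then show ?thesis by (cases a; cases b) (auto simp: memT image_iff)
    qed
    then show ?thesis by blast
  qed
  have cardS: "card S = card (T b) + card (T (\<not> b))" for b
    by (subst (1) S[of b], subst card_Un_disjoint) (auto simp: fin card_image)
  \<comment> \<open>The neighbours of \<open>b # xs\<close> are those in its own half and at most
    one more, its mirror image.\<close>
  have deg: "p \<le> card {ys \<in> T b. adjacent xs ys} + (if xs \<in> T (\<not> b) then 1 else 0)"
    if xs: "xs \<in> T b" for b xs
  proof -
    have "{ys \<in> S. adjacent (b # xs) ys} = Cons b ` {ys \<in> T b. adjacent xs ys} \<union>
        Cons (\<not> b) ` {ys \<in> T (\<not> b). xs = ys}"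
      by (subst S[of b]) auto
    moreover have "card (Cons b ` {ys \<in> T b. adjacent xs ys} \<union> Cons (\<not> b) ` {ys \<in> T (\<not> b). xs = ys}) =
        card {ys \<in> T b. adjacent xs ys} + card {ys \<in> T (\<not> b). xs = ys}"
      by (subst card_Un_disjoint) (auto simp: fin card_image)
    ultimately have "card {ys \<in> S. adjacent (b # xs) ys} =
        card {ys \<in> T b. adjacent xs ys} + card {ys \<in> T (\<not> b). xs = ys}"
      by (simp only:)
    also have "{ys \<in> T (\<not> b). xs = ys} = (if xs \<in> T (\<not> b) then {xs} else {})"
      by auto
    also have "card \<dots> = (if xs \<in> T (\<not> b) then 1 else 0)" by simp
    finally show ?thesis
      using Suc.prems(3)[of "b # xs"] xs by (simp add: memT)
  qed
  show ?case
  proof (cases "\<exists>b. T b = {}")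
    \<comment> \<open>All of \<open>S\<close> lies in one half: degrees carry over and the first
      coordinate becomes fixed.\<close>
    case True
    then obtain c where "T c = {}" by blast
    moreover define b where "b = (\<not> c)"
    ultimately have "T (\<not> b) = {}" by simp
    then have Sb: "S = Cons b ` T b" and card: "card S = card (T b)"
      using S[of b] cardS[of b] by auto
    have "2 ^ p \<le> card (T b) \<and> (card (T b) = 2 ^ p \<longrightarrow> (\<exists>P. length P = n \<and> free_dim P = p \<and> T b = subcube P))"
    proof (rule Suc.IH)
      show "T b \<noteq> {}" using Suc.prems(2) Sb by auto
      show "p \<le> card {ys \<in> T b. adjacent xs ys}" if "xs \<in> T b" for xs
        using deg[OF that] \<open>T (\<not> b) = {}\<close> by simp
    qed (rule len)
    moreover have "\<exists>P. length P = Suc n \<and> free_dim P = p \<and> S = subcube P"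
      if "\<exists>P. length P = n \<and> free_dim P = p \<and> T b = subcube P"
    proof -
      from that obtain P where "length P = n" "free_dim P = p" "T b = subcube P" by blast
      then show ?thesis using Sb by (intro exI[of _ "Some b # P"]) simp
    qed
    ultimately show ?thesis unfolding card by blast
  next
    case False
    show ?thesis
    proof (cases p)
      case 0
      \<comment> \<open>Two nonempty halves already give two elements, so equality with
        \<open>2 ^ 0\<close> cannot occur.\<close>
      have "card (T b) \<noteq> 0" for b using False fin by simp
      from this[of True] this[of False] have "2 \<le> card S" using cardS[of True] by simp
      with 0 show ?thesis by simp
    next
      case (Suc q)
      \<comment> \<open>The mirror image accounts for at most one neighbour, so each half has
        minimum degree at least \<open>q\<close>.\<close>
      have IH: "2 ^ q \<le> card (T b) \<and> (card (T b) = 2 ^ q \<longrightarrow> (\<exists>P. length P = n \<and> free_dim P = q \<and> T b = subcube P))"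
        for b
      proof (rule Suc.IH)
        show "T b \<noteq> {}" using False by blast
        show "q \<le> card {ys \<in> T b. adjacent xs ys}" if "xs \<in> T b" for xs
          using deg[OF that] Suc by (simp split: if_splits)
      qed (rule len)
      have "\<exists>P. length P = Suc n \<and> free_dim P = p \<and> S = subcube P" if "card S = 2 ^ p"
      proof -
        \<comment> \<open>Both halves have at least \<open>2 ^ q\<close> elements and together
          \<open>2 ^ Suc q\<close>, so neither has more.\<close>
        have eq: "card (T b) = 2 ^ q" for b
          using that cardS[of b] IH[of b] IH[of "\<not> b"] Suc by simp
        have sub: "T b \<subseteq> T (\<not> b)" for b
        proof
          fix xs assume xs: "xs \<in> T b"
          obtain P where "free_dim P = q" "T b = subcube P" using eq IH by blast
          with xs have "card {ys \<in> T b. adjacent xs ys} = q"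
            by (simp add: subcube_degree)
          with deg[OF xs] Suc show "xs \<in> T (\<not> b)" by (simp split: if_splits)
        qed
        have "T False = T True" using sub[of True] sub[of False] by auto
        moreover obtain P where "length P = n" "free_dim P = q" "T True = subcube P"
          using eq IH by blast
        ultimately show ?thesis
          using S[of True] Suc by (intro exI[of _ "None # P"]) simp
      qed
      moreover have "2 ^ p \<le> card S"
        using cardS[of True] IH[of True] IH[of False] Suc by simp
      ultimately show ?thesis by blast
    qed
  qed
qed

section \<open>Inclusion of subcubes\<close>

definition frees :: "bool option \<Rightarrow> bool option \<Rightarrow> bool" where
  "frees a a' \<longleftrightarrow> a \<noteq> None \<and> a' = None"

lemma frees_simps [simp]:
  "\<not> frees None a"
  "\<not> frees a (Some b)"
  "frees (Some b) None"
  by (simp_all add: frees_def)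

lemma one_step_frees:
  "one_step frees P P' \<Longrightarrow> free_dim P' = Suc (free_dim P) \<and> subcube P \<subseteq> subcube P'"
proof (induction frees P P' rule: one_step.induct)
  case (1 a P a' P')
  then show ?case by (cases a; cases a') auto
qed auto

text \<open>A coordinate fixed in \<open>P'\<close> admits a single bit, so \<open>P\<close> must
  fix it to the same bit. The relation on entries is the reflexive closure of
  \<open>frees\<close>.\<close>

lemma subcube_subset_imp_frees:
  assumes "subcube P \<subseteq> subcube P'" "length P = length P'"
  shows "list_all2 (\<lambda>a a'. a' = a \<or> a' = None) P P'"
  using assms(2,1)
proof (induction P P' rule: list_induct2)
  case (Cons a P a' P')
  obtain xs where xs: "xs \<in> subcube P" using subcube_nonempty by blast
  have "subcube P \<subseteq> subcube P'"
    using Cons.prems by (cases a; cases a') auto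
  moreover have "a' = a \<or> a' = None"
    using Cons.prems xs by (cases a; cases a') auto
  ultimately show ?case using Cons.IH by simp
qed simp

text \<open>Every position in which the patterns differ adds exactly one free coordinate.\<close>

lemma frees_dim_le:
  "list_all2 (\<lambda>a a'. a' = a \<or> a' = None) P P' \<Longrightarrow> free_dim P \<le> free_dim P' \<and> (free_dim P' = free_dim P \<longrightarrow> P = P')"
proof (induction P P' rule: list_all2_induct)
  case (Cons a P a' P')
  then show ?case by (cases a; cases a') auto
qed simp

lemma frees_dim_Suc:
  "list_all2 (\<lambda>a a'. a' = a \<or> a' = None) P P' \<Longrightarrow> free_dim P' = Suc (free_dim P) \<Longrightarrow> one_step frees P P'"
proof (induction P P' rule: list_all2_induct)
  case (Cons a P a' P')
  then show ?case using frees_dim_le[OF Cons.hyps(2)] by (cases a; cases a') auto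
qed simp

text \<open>Reduces maximality, which compares dimensions \<open>p\<close> and \<open>p + 1\<close>,
  to changes of a single coordinate.\<close>

lemma subcube_subset_iff_one_step:
  assumes "length P = length P'" "free_dim P' = Suc (free_dim P)"
  shows "subcube P \<subseteq> subcube P' \<longleftrightarrow> one_step frees P P'"
  using assms subcube_subset_imp_frees frees_dim_Suc one_step_frees by blast

text \<open>Inclusions both ways make the dimensions equal, and then the patterns. Hence patterns
  can be counted in place of vertex sets.\<close>

lemma subcube_inj:
  assumes "subcube P = subcube P'"
  shows "P = P'"
proof -
  obtain xs where "xs \<in> subcube P" using subcube_nonempty by blast
  with assms have "length P = length P'" using subcube_length by metis
  with assms have "list_all2 (\<lambda>a a'. a' = a \<or> a' = None) P P'"
    "list_all2 (\<lambda>a a'. a' = a \<or> a' = None) P' P"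
    using subcube_subset_imp_frees by auto
  then show ?thesis using frees_dim_le by (meson le_antisym)
qed

section \<open>Subcubes of the Fibonacci cube\<close>

lemma fib_string_simps [simp]:
  "fib_string []" "fib_string [x]"
  "fib_string (x # y # xs) \<longleftrightarrow> \<not> (x \<and> y) \<and> fib_string (y # xs)"
  by (auto simp: fib_string_def nth_Cons split: nat.splits)

definition top_string :: "bool option list \<Rightarrow> bool list" where
  "top_string = map (\<lambda>a. a \<noteq> Some False)"

text \<open>The interval from the all-zero string up to \<open>t\<close>, written as a
  pattern.\<close>

definition down_pattern :: "bool list \<Rightarrow> bool option list" where
  "down_pattern = map (\<lambda>b. if b then None else Some False)"

lemma length_top_string [simp]: "length (top_string P) = length P"
  by (simp add: top_string_def)

lemma length_down_pattern [simp]: "length (down_pattern t) = length t"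
  by (simp add: down_pattern_def)

lemma top_string_down_pattern [simp]: "top_string (down_pattern t) = t"
  by (induction t) (auto simp: top_string_def down_pattern_def)

lemma free_dim_down_pattern: "free_dim (down_pattern t) = count_list t True"
  by (induction t) (auto simp: down_pattern_def)

lemma top_string_in_subcube: "top_string P \<in> subcube P"
  by (induction P rule: subcube.induct) (auto simp: top_string_def)

lemma subcube_le_top_string:
  "xs \<in> subcube P \<Longrightarrow> list_all2 (\<le>) xs (top_string P)"
  by (induction P arbitrary: xs rule: subcube.induct) (auto simp: top_string_def)

lemma fib_string_mono:
  "list_all2 (\<le>) xs ys \<Longrightarrow> fib_string ys \<Longrightarrow> fib_string (xs :: bool list)"
  unfolding fib_string_def list_all2_conv_all_nth by (metis Suc_lessD le_boolD)

text \<open>Fibonacci strings are closed under changing 1s to 0s, and \<open>top_string P\<close> is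
  the coordinatewise largest string of the subcube.\<close>

lemma subcube_subset_fib_iff:
  "(\<forall>xs \<in> subcube P. fib_string xs) \<longleftrightarrow> fib_string (top_string P)"
  using top_string_in_subcube subcube_le_top_string fib_string_mono by blast

text \<open>On \<open>bool\<close>, \<open><\<close> holds only from \<open>False\<close> to
  \<open>True\<close>. As Fibonacci strings are downward closed, testing single changes captures
  maximality in the coordinatewise order.\<close>

definition maximal_fib :: "bool list \<Rightarrow> bool" where
  "maximal_fib t \<longleftrightarrow> fib_string t \<and> \<not> (\<exists>t'. one_step (<) t t' \<and> fib_string t')"

text \<open>The fixed coordinates of \<open>down_pattern t\<close> are the zeros of
  \<open>t\<close>, and freeing one amounts to raising it.\<close>

lemma one_step_frees_down_pattern:
  "one_step frees (down_pattern t) P' \<longleftrightarrow> (\<exists>t'. one_step (<) t t' \<and> P' = down_pattern t')"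
proof (induction t arbitrary: P')
  case (Cons b t)
  have C: "down_pattern (b # t) = (if b then None else Some False) # down_pattern t" for b t
    by (simp add: down_pattern_def)
  have tail: "(\<exists>zs. P' = a # zs \<and> one_step frees (down_pattern t) zs) \<longleftrightarrow>
      (\<exists>t'. one_step (<) t t' \<and> P' = a # down_pattern t')" for a
    unfolding Cons.IH by blast
  have head: "(\<exists>a'. frees (Some False) a' \<and> P' = a' # down_pattern t) \<longleftrightarrow> P' = None # down_pattern t"
    by (auto simp: frees_def)
  show ?case
    unfolding ex_one_step_Cons
    by (cases b; simp only: C one_step_Cons tail if_True if_False head) (simp_all add: ex_bool_eq C)
qed (simp add: down_pattern_def)

text \<open>The top string has a 1 at such a coordinate whether it is fixed or free. So a pattern
  with a coordinate fixed at 1 is never maximal.\<close>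

lemma frees_Some_True:
  "Some True \<in> set P \<Longrightarrow> \<exists>P'. one_step frees P P' \<and> top_string P' = top_string P"
proof (induction P)
  case (Cons a P)
  show ?case
  proof (cases "a = Some True")
    case True
    then show ?thesis by (intro exI[of _ "None # P"]) (simp add: top_string_def)
  next
    case False
    with Cons obtain P' where "one_step frees P P'" "top_string P' = top_string P" by auto
    then show ?thesis by (intro exI[of _ "a # P'"]) (simp add: top_string_def)
  qed
qed simp

lemma down_pattern_top_string:
  "Some True \<notin> set P \<Longrightarrow> down_pattern (top_string P) = P"
proof (induction P)
  case (Cons a P)
  then show ?case by (cases a) (auto simp: top_string_def down_pattern_def)
qed (simp add: top_string_def down_pattern_def)

text \<open>Maximality forbids entries \<open>Some True\<close>, which leaves only patterns of the
  form \<open>down_pattern t\<close>; for these, freeing a coordinate is raising a zero.\<close>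

lemma maximal_pattern_iff:
  "fib_string (top_string P) \<and> \<not> (\<exists>P'. one_step frees P P' \<and> fib_string (top_string P')) \<longleftrightarrow>
    (\<exists>t. P = down_pattern t \<and> maximal_fib t)" (is "?L \<longleftrightarrow> ?R")
proof
  assume L: ?L
  then have "Some True \<notin> set P" using frees_Some_True by metis
  then have P: "P = down_pattern (top_string P)" by (simp add: down_pattern_top_string)
  have "\<not> (\<exists>t'. one_step (<) (top_string P) t' \<and> fib_string t')"
  proof
    assume "\<exists>t'. one_step (<) (top_string P) t' \<and> fib_string t'"
    then obtain t' where t': "one_step (<) (top_string P) t'" "fib_string t'" by blast
    then have "one_step frees P (down_pattern t')"
      using one_step_frees_down_pattern[of "top_string P"] P by auto
    with L t' show False by force
  qed
  with L P show ?R unfolding maximal_fib_def by blast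
next
  assume ?R
  then obtain t where "P = down_pattern t" "maximal_fib t" by blast
  then show ?L by (metis maximal_fib_def one_step_frees_down_pattern top_string_down_pattern)
qed

section \<open>Counting maximal Fibonacci strings\<close>

lemma fib_string_False_Cons [simp]: "fib_string (False # t) \<longleftrightarrow> fib_string t"
  by (cases t) auto

text \<open>In the prefixes 10 and 010 every 0 is blocked by the adjacent 1, while the final 0 puts
  no constraint on the rest, which is thus an arbitrary maximal string.\<close>

lemma maximal_fib_simps:
  "maximal_fib []"
  "maximal_fib [b] \<longleftrightarrow> b"
  "maximal_fib [a, b] \<longleftrightarrow> a \<noteq> b"
  "\<not> maximal_fib (True # True # t)"
  "\<not> maximal_fib (False # True # True # t)"
  "maximal_fib (True # False # t) \<longleftrightarrow> maximal_fib t"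
  "maximal_fib (False # True # False # t) \<longleftrightarrow> maximal_fib t"
  unfolding maximal_fib_def ex_one_step_Cons ex_bool_eq by auto

text \<open>If \<open>c\<close> is 1, the first 0 can be raised; if \<open>c\<close> is 0, the
  second one can.\<close>

lemma not_maximal_fib_False_False: "\<not> maximal_fib (False # False # c # t)"
proof
  assume max: "maximal_fib (False # False # c # t)"
  show False
  proof (cases c)
    case True
    then have "one_step (<) (False # False # c # t) (True # False # c # t)"
      "fib_string (True # False # c # t)"
      using max by (auto simp: maximal_fib_def)
    with max show False unfolding maximal_fib_def by blast
  next
    case False
    then have "one_step (<) (False # False # c # t) (False # True # c # t)"
      "fib_string (False # True # c # t)"
      using max by (auto simp: maximal_fib_def)
    with max show False unfolding maximal_fib_def by blast
  qed
qed

definition maximal_fib_strings :: "nat \<Rightarrow> nat \<Rightarrow> bool list set" where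
  "maximal_fib_strings n p = {t. length t = n \<and> maximal_fib t \<and> count_list t True = p}"

lemma finite_maximal_fib_strings: "finite (maximal_fib_strings n p)"
  by (rule finite_subset[OF _ finite_lists_length_eq[of UNIV n]]) (auto simp: maximal_fib_strings_def)

text \<open>Prefixes 11, 011 and 00 are excluded; 10 and 010 remain, each containing a single
  1.\<close>

lemma maximal_fib_strings_rec:
  "maximal_fib_strings (n + 3) (Suc p) =
    (\<lambda>t. True # False # t) ` maximal_fib_strings (n + 1) p \<union>
    (\<lambda>t. False # True # False # t) ` maximal_fib_strings n p" (is "?L = ?R")
proof (intro set_eqI)
  fix t
  show "t \<in> ?L \<longleftrightarrow> t \<in> ?R"
  proof (cases "length t = n + 3")
    case True
    then obtain a b c u where t: "t = a # b # c # u" "length u = n"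
      by (auto simp: numeral_3_eq_3 length_Suc_conv)
    then show ?thesis
      by (cases a; cases b; cases c)
        (auto simp: maximal_fib_strings_def maximal_fib_simps not_maximal_fib_False_False image_iff)
  qed (auto simp: maximal_fib_strings_def)
qed

lemma maximal_fib_strings_0: "maximal_fib_strings (n + 3) 0 = {}"
proof -
  have False if "t \<in> maximal_fib_strings (n + 3) 0" for t
  proof -
    have "length t = n + 3" using that by (simp add: maximal_fib_strings_def)
    then obtain a b c u where t: "t = a # b # c # u"
      by (auto simp: numeral_3_eq_3 length_Suc_conv)
    then show False
      using that by (cases a; cases b) (auto simp: maximal_fib_strings_def maximal_fib_simps not_maximal_fib_False_False)
  qed
  then show ?thesis by blast
qed

text \<open>The guard keeps truncated subtraction from turning a negative lower index into 0, where
  the binomial would be 1.\<close>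

lemma card_maximal_fib_strings:
  "card (maximal_fib_strings n p) = (if 2 * p \<le> n + 1 then (p + 1) choose (n + 1 - 2 * p) else 0)"
proof (induction n arbitrary: p rule: less_induct)
  case (less n)
  consider "n = 0" | "n = 1" | "n = 2" | m where "n = m + 3"
    by (metis add.commute le_Suc_ex less_Suc_eq less_one not_le numeral_2_eq_2 numeral_3_eq_3 One_nat_def)
  then show ?case
  proof cases
    case 1
    then have "maximal_fib_strings n p = (if p = 0 then {[]} else {})"
      by (auto simp: maximal_fib_strings_def maximal_fib_simps)
    with 1 show ?thesis by (cases p) auto
  next
    case 2
    then have "maximal_fib_strings n p = (if p = 1 then {[True]} else {})"
      by (auto simp: maximal_fib_strings_def maximal_fib_simps length_Suc_conv)
    with 2 show ?thesis by (cases p) auto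
  next
    case 3
    then have eq: "maximal_fib_strings n p = (if p = 1 then {[True, False], [False, True]} else {})"
      by (auto simp: maximal_fib_strings_def maximal_fib_simps length_Suc_conv numeral_2_eq_2 split: if_splits)
    consider "p = 0" | "p = 1" | "p \<ge> 2" by linarith
    then show ?thesis unfolding eq using 3 by cases (auto simp: numeral_eq_Suc)
  next
    case 4
    show ?thesis
    proof (cases p)
      case 0
      \<comment> \<open>Here the formula reads 1 choose \<open>m + 4\<close>, which is 0.\<close>
      with 4 show ?thesis by (simp add: maximal_fib_strings_0)
    next
      case (Suc q)
      have "card (maximal_fib_strings n p) =
          card (maximal_fib_strings (m + 1) q) + card (maximal_fib_strings m q)"
        unfolding 4 Suc maximal_fib_strings_rec
        by (subst card_Un_disjoint)
          (auto simp: finite_maximal_fib_strings card_image inj_on_def)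
      also have "\<dots> = (if 2 * q \<le> m + 2 then (q + 1) choose (m + 2 - 2 * q) else 0) +
          (if 2 * q \<le> m + 1 then (q + 1) choose (m + 1 - 2 * q) else 0)"
        using 4 by (simp add: less.IH)
      also have "\<dots> = (if 2 * q \<le> m + 2 then (q + 2) choose (m + 2 - 2 * q) else 0)"
      proof (cases "2 * q \<le> m + 1")
        case True
        \<comment> \<open>The successor form exposes Pascal's rule.\<close>
        then have "m + 2 - 2 * q = Suc (m + 1 - 2 * q)" by simp
        then show ?thesis using True by simp
      next
        case False
        \<comment> \<open>Either \<open>2 * q = m + 2\<close>, where both sides are 1 because the
          lower index is 0, or everything vanishes.\<close>
        then show ?thesis by auto
      qed
      finally show ?thesis using 4 Suc by (simp add: numeral_eq_Suc)
    qed
  qed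
qed

section \<open>Hypercubes in the Fibonacci cube\<close>

lemma verts_fibonacci_cube: "verts (fibonacci_cube n) = {xs. length xs = n \<and> fib_string xs}"
  by (simp add: fibonacci_cube_def)

lemma arcs_fibonacci_cube:
  "arcs (fibonacci_cube n) = {(xs, ys). length xs = n \<and> length ys = n \<and>
    fib_string xs \<and> fib_string ys \<and> adjacent xs ys}"
  by (auto simp: fibonacci_cube_def parcs_hypercube)

lemma tail_fibonacci_cube: "tail (fibonacci_cube n) = fst"
  and head_fibonacci_cube: "head (fibonacci_cube n) = snd"
  by (simp_all add: fibonacci_cube_def)

lemmas fibonacci_cube_simps =
  verts_fibonacci_cube arcs_fibonacci_cube tail_fibonacci_cube head_fibonacci_cube

text \<open>Compatibility shares the head and tail maps, so the vertex set determines the whole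
  graph.\<close>

lemma induced_subgraph_eq_induce:
  assumes "induced_subgraph H G"
  shows "H = G \<restriction> verts H"
  using assms
  by (auto simp: induced_subgraph_def subgraph_def compatible_def induce_subgraph_def
      intro!: pre_digraph.equality)

lemma out_degree_induce_fibonacci_cube:
  assumes "xs \<in> S" "S \<subseteq> verts (fibonacci_cube n)"
  shows "out_degree (fibonacci_cube n \<restriction> S) xs = card {ys \<in> S. adjacent xs ys}"
proof -
  have "out_arcs (fibonacci_cube n \<restriction> S) xs = Pair xs ` {ys \<in> S. adjacent xs ys}"
    using assms by (auto simp: out_arcs_def fibonacci_cube_simps)
  then show ?thesis by (simp add: out_degree_def card_image inj_on_def)
qed

text \<open>Viewing the hypercube as the all-free subcube lets \<open>subcube_degree\<close> show
  that it is regular.\<close>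

lemma hypercube_eq_subcube: "pverts (hypercube p) = subcube (replicate p None)"
proof (induction p)
  case 0
  then show ?case by (simp add: hypercube_def)
next
  case (Suc p)
  then show ?case by (auto simp: hypercube_def length_Suc_conv)
qed

lemma free_dim_replicate_None: "free_dim (replicate p None) = p"
  by (induction p) auto

lemma out_degree_hypercube:
  assumes "xs \<in> pverts (hypercube p)"
  shows "out_degree (with_proj (hypercube p)) xs = p"
proof -
  have "out_arcs (with_proj (hypercube p)) xs = Pair xs ` {ys \<in> pverts (hypercube p). adjacent xs ys}"
    using assms by (auto simp: out_arcs_def parcs_hypercube) (auto simp: hypercube_def)
  then have "out_degree (with_proj (hypercube p)) xs = card {ys \<in> pverts (hypercube p). adjacent xs ys}"
    by (simp add: out_degree_def card_image inj_on_def)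
  also have "\<dots> = p"
    using assms subcube_degree[of xs "replicate p None"]
    by (simp add: hypercube_eq_subcube free_dim_replicate_None)
  finally show ?thesis .
qed

text \<open>The isomorphism transports the order \<open>2 ^ p\<close> and the degree
  \<open>p\<close>; this is the equality case of \<open>min_degree_card_subcube\<close>.\<close>

lemma digraph_iso_hypercube_imp_subcube:
  assumes S: "S \<subseteq> verts (fibonacci_cube n)"
    and iso: "digraph_iso (fibonacci_cube n \<restriction> S) (with_proj (hypercube p))"
  shows "\<exists>P. length P = n \<and> free_dim P = p \<and> S = subcube P"
proof -
  let ?H = "fibonacci_cube n \<restriction> S"
  obtain f where f: "pre_digraph.digraph_isomorphism ?H f" "with_proj (hypercube p) = app_iso f ?H"
    using iso unfolding digraph_iso_def by blast
  interpret H: wf_digraph ?H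
    using f(1) by (simp add: pre_digraph.digraph_isomorphism_def)
  have im: "iso_verts f ` S = pverts (hypercube p)"
    using f(2) by (metis induce_subgraph_verts verts_app_iso with_proj_simps(1))
  have deg: "card {ys \<in> S. adjacent xs ys} = p" if "xs \<in> S" for xs
  proof -
    have "out_degree ?H xs = out_degree (with_proj (hypercube p)) (iso_verts f xs)"
      unfolding f(2) using H.out_degree_app_iso_eq[OF f(1)] that by simp
    also have "\<dots> = p" using im that by (intro out_degree_hypercube) auto
    finally show ?thesis using out_degree_induce_fibonacci_cube[OF that S] by simp
  qed
  have "inj_on (iso_verts f) S"
    using H.digraph_isomorphism_inj_on_verts[OF f(1)] by simp
  then have "card S = card (pverts (hypercube p))"
    using im by (metis card_image)
  also have "\<dots> = 2 ^ p"
    using card_lists_length_eq[of "UNIV :: bool set" p] by (simp add: hypercube_def)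
  finally have card: "card S = 2 ^ p" .
  then have "S \<noteq> {}" by auto
  have "length xs = n" if "xs \<in> S" for xs
    using S that by (auto simp: fibonacci_cube_simps)
  with card \<open>S \<noteq> {}\<close> deg show ?thesis
    using min_degree_card_subcube[of S n p] by simp
qed

lemma digraph_iso_subcube_hypercube:
  assumes S: "subcube P \<subseteq> verts (fibonacci_cube n)"
  shows "digraph_iso (fibonacci_cube n \<restriction> subcube P) (with_proj (hypercube (free_dim P)))"
proof -
  let ?H = "fibonacci_cube n \<restriction> subcube P"
  \<comment> \<open>Arcs are pairs in both graphs, so the arc map acts on both ends and the new tail
    and head are projections.\<close>
  let ?f = "\<lparr>iso_verts = free_part P, iso_arcs = map_prod (free_part P) (free_part P),
    iso_head = snd, iso_tail = fst\<rparr>"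
  have wf: "wf_digraph ?H"
    using S wf_digraph_fibonacci_cube by (simp add: wf_digraph.wellformed_induce_subgraph)
  have arcs: "arcs ?H = {(xs, ys). xs \<in> subcube P \<and> ys \<in> subcube P \<and> adjacent xs ys}"
    using S by (auto simp: fibonacci_cube_simps)
  have "inj_on (free_part P) (subcube P)" by (simp add: inj_on_def free_part_inj)
  then have "pre_digraph.digraph_isomorphism ?H ?f"
    unfolding pre_digraph.digraph_isomorphism_def using wf
    by (auto simp: arcs inj_on_def tail_fibonacci_cube head_fibonacci_cube)
  moreover have "with_proj (hypercube (free_dim P)) = app_iso ?f ?H"
  proof (rule pre_digraph.equality)
    show "verts (with_proj (hypercube (free_dim P))) = verts (app_iso ?f ?H)"
      using free_part_image[of P] by (simp add: hypercube_def)
    have iff: "(us, vs) \<in> parcs (hypercube (free_dim P)) \<longleftrightarrow> (us, vs) \<in> map_prod (free_part P) (free_part P) ` arcs ?H"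
      for us vs
    proof
      assume "(us, vs) \<in> parcs (hypercube (free_dim P))"
      then have "us \<in> free_part P ` subcube P" "vs \<in> free_part P ` subcube P" "adjacent us vs"
        unfolding free_part_image by (auto simp: parcs_hypercube)
      then obtain xs ys where "us = free_part P xs" "xs \<in> subcube P" "vs = free_part P ys"
        "ys \<in> subcube P" "adjacent xs ys"
        by (auto simp: free_part_adjacent)
      then show "(us, vs) \<in> map_prod (free_part P) (free_part P) ` arcs ?H"
        unfolding arcs by (intro image_eqI[of _ _ "(xs, ys)"]) auto
    next
      assume "(us, vs) \<in> map_prod (free_part P) (free_part P) ` arcs ?H"
      then obtain xs ys where *: "us = free_part P xs" "xs \<in> subcube P" "vs = free_part P ys"
        "ys \<in> subcube P" "adjacent xs ys"
        unfolding arcs by auto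
      then have "us \<in> free_part P ` subcube P" "vs \<in> free_part P ` subcube P" by auto
      with * show "(us, vs) \<in> parcs (hypercube (free_dim P))"
        unfolding free_part_image by (simp add: parcs_hypercube free_part_adjacent)
    qed
    have "parcs (hypercube (free_dim P)) = map_prod (free_part P) (free_part P) ` arcs ?H"
    proof (rule set_eqI)
      show "e \<in> parcs (hypercube (free_dim P)) \<longleftrightarrow> e \<in> map_prod (free_part P) (free_part P) ` arcs ?H"
        for e by (cases e) (simp only: iff)
    qed
    then show "arcs (with_proj (hypercube (free_dim P))) = arcs (app_iso ?f ?H)"
      by (simp only: with_proj_simps arcs_app_iso digraph_isomorphism.select_convs)
  qed simp_all
  ultimately show ?thesis unfolding digraph_iso_def by blast
qed

lemma subcube_subset_fibonacci_cube_iff: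
  "subcube P \<subseteq> verts (fibonacci_cube n) \<longleftrightarrow> length P = n \<and> fib_string (top_string P)"
proof -
  obtain xs where "xs \<in> subcube P" using subcube_nonempty by blast
  then have "(\<forall>xs \<in> subcube P. length xs = n) \<longleftrightarrow> length P = n"
    using subcube_length by metis
  then show ?thesis
    using subcube_subset_fib_iff[of P] unfolding verts_fibonacci_cube by auto
qed

lemma hypercubes_in_fibonacci_cube:
  "hypercubes_in p (fibonacci_cube n) =
    (\<lambda>P. fibonacci_cube n \<restriction> subcube P) ` {P. length P = n \<and> free_dim P = p \<and> fib_string (top_string P)}"
    (is "?L = ?F ` ?A")
proof (intro set_eqI iffI)
  fix H assume "H \<in> ?L"
  then have ind: "induced_subgraph H (fibonacci_cube n)"
    and iso: "digraph_iso H (with_proj (hypercube p))"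
    by (auto simp: hypercubes_in_def)
  have H: "H = fibonacci_cube n \<restriction> verts H" using ind by (rule induced_subgraph_eq_induce)
  have sub: "verts H \<subseteq> verts (fibonacci_cube n)"
    using ind by (auto simp: induced_subgraph_def subgraph_def)
  obtain P where P: "length P = n" "free_dim P = p" "verts H = subcube P"
    using digraph_iso_hypercube_imp_subcube[OF sub] iso H by metis
  with sub have "fib_string (top_string P)" by (simp add: subcube_subset_fibonacci_cube_iff)
  with P H show "H \<in> ?F ` ?A" by (metis (mono_tags, lifting) image_eqI mem_Collect_eq)
next
  fix H assume "H \<in> ?F ` ?A"
  then obtain P where P: "H = ?F P" "length P = n" "free_dim P = p" "fib_string (top_string P)"
    by blast
  then have sub: "subcube P \<subseteq> verts (fibonacci_cube n)"
    by (simp add: subcube_subset_fibonacci_cube_iff)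
  have "induced_subgraph H (fibonacci_cube n)"
    unfolding P(1) by (rule wf_digraph.induced_induce[OF wf_digraph_fibonacci_cube sub])
  with digraph_iso_subcube_hypercube[OF sub] P show "H \<in> ?L"
    by (simp add: hypercubes_in_def)
qed

lemma subgraph_induce_iff:
  assumes "wf_digraph G"
  shows "subgraph (G \<restriction> S) (G \<restriction> T) \<longleftrightarrow> S \<subseteq> T"
  using assms
  by (auto simp: subgraph_def compatible_def wf_digraph.wellformed_induce_subgraph)

lemma maximal_hypercubes_in_fibonacci_cube:
  "maximal_hypercubes_in p (fibonacci_cube n) =
    (\<lambda>t. fibonacci_cube n \<restriction> subcube (down_pattern t)) ` maximal_fib_strings n p"
proof -
  let ?F = "\<lambda>P. fibonacci_cube n \<restriction> subcube P"
  have "maximal_hypercubes_in p (fibonacci_cube n) = ?F ` {P. length P = n \<and> free_dim P = p \<and>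
      fib_string (top_string P) \<and> \<not> (\<exists>P'. length P' = n \<and> free_dim P' = p + 1 \<and>
      fib_string (top_string P') \<and> subcube P \<subseteq> subcube P')}"
    unfolding maximal_hypercubes_in_def hypercubes_in_fibonacci_cube
    by (auto simp: subgraph_induce_iff[OF wf_digraph_fibonacci_cube])
  also have "{P. length P = n \<and> free_dim P = p \<and>
      fib_string (top_string P) \<and> \<not> (\<exists>P'. length P' = n \<and> free_dim P' = p + 1 \<and>
      fib_string (top_string P') \<and> subcube P \<subseteq> subcube P')} =
      {P. length P = n \<and> free_dim P = p \<and> fib_string (top_string P) \<and>
      \<not> (\<exists>P'. one_step frees P P' \<and> fib_string (top_string P'))}"
  proof -
    \<comment> \<open>A freeing step preserves length and adds one dimension, so it carries the
      conditions on \<open>P'\<close> with it; the converse is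
      \<open>subcube_subset_iff_one_step\<close>.\<close>
    have "(length P' = n \<and> free_dim P' = p + 1 \<and> fib_string (top_string P') \<and> subcube P \<subseteq> subcube P') \<longleftrightarrow>
        one_step frees P P' \<and> fib_string (top_string P')"
      if "length P = n" "free_dim P = p" for P P'
      using that subcube_subset_iff_one_step[of P P'] one_step_frees[of P P'] one_step_length[of frees P P']
      by auto
    then show ?thesis by blast
  qed
  also have "\<dots> = down_pattern ` maximal_fib_strings n p"
    unfolding maximal_pattern_iff
    by (auto simp: maximal_fib_strings_def free_dim_down_pattern)
  finally show ?thesis by (simp add: image_image)
qed

theorem theorem1:
  fixes n p :: nat
  assumes "p \<le> n"
  shows "card (maximal_hypercubes_in p (fibonacci_cube n)) =
    int_binomial (int p + 1) (int n - 2 * int p + 1)"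
proof -
  \<comment> \<open>The graph determines its vertex set, this its pattern, and the top string of the
    pattern is \<open>t\<close>.\<close>
  have "inj_on (\<lambda>t. fibonacci_cube n \<restriction> subcube (down_pattern t)) (maximal_fib_strings n p)"
  proof (rule inj_onI)
    fix t u
    assume "fibonacci_cube n \<restriction> subcube (down_pattern t) = fibonacci_cube n \<restriction> subcube (down_pattern u)"
    then have "subcube (down_pattern t) = subcube (down_pattern u)"
      using induce_subgraph_verts by metis
    then have "down_pattern t = down_pattern u" by (rule subcube_inj)
    then show "t = u" using top_string_down_pattern by metis
  qed
  then have "card (maximal_hypercubes_in p (fibonacci_cube n)) = card (maximal_fib_strings n p)"
    unfolding maximal_hypercubes_in_fibonacci_cube by (rule card_image)
  also have "\<dots> = int_binomial (int p + 1) (int n - 2 * int p + 1)"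
  \<comment> \<open>The guard holds exactly when the integer lower index is nonnegative; an index
    above \<open>p + 1\<close> gives 0 under both conventions.\<close>
  proof (cases "2 * p \<le> n + 1")
    case True
    then have "int n - 2 * int p + 1 = int (n + 1 - 2 * p)" "int p + 1 = int (p + 1)" by auto
    then show ?thesis
      using True unfolding card_maximal_fib_strings int_binomial_def
      by (simp only: nat_int) (simp add: binomial_eq_0)
  next
    case False
    then show ?thesis
      unfolding card_maximal_fib_strings int_binomial_def by auto
  qed
  finally show ?thesis .
qed

end
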